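(* Let $V\subseteq\mathbb A^n$ be an affine variety defined over $\mathbb Q$ by homogeneous equations, with $V(\mathbb Q)\cap\mathbb Q_{>0}^n$ nonempty, and let $\mathscr Y_V$ be its rational-ray visibility datum. Suppose that for some real $c>0$, $\alpha\ge1$ and $\beta\ge0$ one has, as $X\to\infty$, $$P_V(X)\sim cX^\alpha(\log X)^\beta.$$ If $\alpha>1$, then $$N_V(X)\sim c\,\zeta(\alpha)X^\alpha(\log X)^\beta,$$ and consequently $\mathfrak d^{\mathrm{vis}}(\mathscr Y_V)=\frac1{\zeta(\alpha)}$. For every prime $p$, $\mathfrak d_p^{\mathrm{vis}}(\mathscr Y_V)=1-p^{-\alpha}$, so that $\mathfrak d^{\mathrm{vis}}(\mathscr Y_V)=\prod_p\mathfrak d_p^{\mathrm{vis}}(\mathscr Y_V)$. If $\alpha=1$, then $$N_V(X)\sim\frac{c}{\beta+1}X(\log X)^{\beta+1}.$$ In this case the globally visible points have relative density zero, while for every prime $p$ one has $\mathfrak d_p^{\mathrm{vis}}(\mathscr Y_V)=1-\frac1p$. Thus the Euler product $\prod_p\mathfrak d_p^{\mathrm{vis}}(\mathscr Y_V)$ of the local densities is zero and again agrees with the global density.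
   Context: Rational-ray datum: for every class $[v]\in(V(\mathbb Q)\cap\mathbb Q_{>0}^n)/\mathbb Q_{>0}$ choose a representative $v$ and define the ordered branch $\phi_{[v]}(t)=tv$, $t>0$; $\mathscr Y_V$ is the collection of these branches. Its branch locus is $\mathcal B(\mathscr Y_V)=V(\mathbb Z)\cap\mathbb Z_{>0}^n$. For $P\in\mathbb Z^n$ put $v_p(P)=\min_iv_p(P_i)$ and $H(P)=\max_i|P_i|$. A branch point $\phi_{[v]}(t)$ is globally visible if there is no real $s$ with $0<s<t$ and $\phi_{[v]}(s)\in\mathbb Z^n$; it is $p$-adically visible if $v_p(\phi_{[v]}(t))\le v_p(\phi_{[v]}(s))$ for all such $s$. $\mathcal B(\mathscr Y_V;X)$ is the set of branch points with $H\le X$; $N_V(X)=\#\mathcal B(\mathscr Y_V;X)$; $P_V(X)$ is the number of primitive points (coordinates with gcd $1$; equivalently globally visible points) in $\mathcal B(\mathscr Y_V;X)$. The relative density of $\mathcal S\subseteq\mathcal B(\mathscr Y_V)$ is $\lim_{X\to\infty}\#(\mathcal S\cap\mathcal B(\mathscr Y_V;X))/N_V(X)$; $\mathfrak d^{\mathrm{vis}}$ and $\mathfrak d_p^{\mathrm{vis}}$ are the relative densities of the globally visible and $p$-adically visible points. Infinite products over primes are limits of the partial products over $p\le Y$ (the value $0$ is allowed). $\zeta$ is the Riemann zeta function. *)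

theory Defs
  imports
    "HOL-Analysis.Analysis"
    "HOL-Library.Poly_Mapping"
    "HOL-Library.Landau_Symbols"
    "HOL-Library.Extended_Nat"
    "HOL-Computational_Algebra.Primes"
begin

section \<open>Polynomials in finitely many variables and their zero loci\<close>

text \<open>A polynomial over the rationals in variables indexed by \<open>'n\<close> is a finitely supported map
  from exponent vectors to coefficients.\<close>

type_synonym 'n qpoly = "(('n, nat) poly_mapping, rat) poly_mapping"

definition qpoly_eval :: "'n::finite qpoly \<Rightarrow> rat ^ 'n \<Rightarrow> rat" where
  "qpoly_eval f x =
     (\<Sum>m\<in>Poly_Mapping.keys f.
        Poly_Mapping.lookup f m * (\<Prod>i\<in>UNIV. (x $ i) ^ Poly_Mapping.lookup m i))"

definition homogeneous_qpoly :: "'n::finite qpoly \<Rightarrow> bool" where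
  "homogeneous_qpoly f \<longleftrightarrow>
     (\<exists>d::nat. \<forall>m\<in>Poly_Mapping.keys f. (\<Sum>i\<in>UNIV. Poly_Mapping.lookup m i) = d)"

text \<open>The variety \<open>V\<close> is given by a set \<open>F\<close> of defining equations; the next two sets are
  its rational and its integral points.\<close>

definition rational_points :: "'n::finite qpoly set \<Rightarrow> (rat ^ 'n) set" where
  "rational_points F = {x. \<forall>f\<in>F. qpoly_eval f x = 0}"

definition rat_vec :: "int ^ 'n \<Rightarrow> rat ^ 'n" where
  "rat_vec P = (\<chi> i. of_int (P $ i))"

definition integral_points :: "'n::finite qpoly set \<Rightarrow> (int ^ 'n) set" where
  "integral_points F = {P. rat_vec P \<in> rational_points F}"

definition positive_rational_points :: "'n::finite qpoly set \<Rightarrow> (rat ^ 'n) set" where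
  "positive_rational_points F = {x \<in> rational_points F. \<forall>i. x $ i > 0}"


section \<open>The rational-ray visibility datum\<close>

definition ray_rel :: "'n::finite qpoly set \<Rightarrow> (rat ^ 'n) rel" where
  "ray_rel F = {(u, v). u \<in> positive_rational_points F \<and> v \<in> positive_rational_points F \<and>
                        (\<exists>q>0. u = q *s v)}"

definition real_vec_of_rat :: "rat ^ 'n \<Rightarrow> real ^ 'n" where
  "real_vec_of_rat v = (\<chi> i. of_rat (v $ i))"

definition real_vec_of_int :: "int ^ 'n \<Rightarrow> real ^ 'n" where
  "real_vec_of_int P = (\<chi> i. of_int (P $ i))"

text \<open>A branch is a parametrised ray; only its values at parameters \<open>t > 0\<close> are ever used.\<close>

definition ray_branch :: "rat ^ 'n \<Rightarrow> real \<Rightarrow> real ^ 'n" where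
  "ray_branch v t = t *\<^sub>R real_vec_of_rat v"

text \<open>The datum depends on a choice of representatives, so it is a predicate on collections
  \<open>Y\<close> of branches: \<open>Y\<close> arises from some choice function \<open>rep\<close> on the set of classes.\<close>

definition rational_ray_datum ::
    "'n::finite qpoly set \<Rightarrow> (real \<Rightarrow> real ^ 'n) set \<Rightarrow> bool" where
  "rational_ray_datum F Y \<longleftrightarrow>
     (\<exists>rep. (\<forall>C \<in> positive_rational_points F // ray_rel F. rep C \<in> C) \<and>
            Y = (\<lambda>C. ray_branch (rep C)) ` (positive_rational_points F // ray_rel F))"

definition branch_locus :: "'n::finite qpoly set \<Rightarrow> (int ^ 'n) set" where
  "branch_locus F = {P \<in> integral_points F. \<forall>i. P $ i > 0}"

definition height :: "int ^ 'n::finite \<Rightarrow> int" where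
  "height P = Max (range (\<lambda>i. \<bar>P $ i\<bar>))"

text \<open>The valuation takes the value \<open>\<infinity>\<close> at \<open>0\<close>.\<close>

definition int_val :: "nat \<Rightarrow> int \<Rightarrow> enat" where
  "int_val p a = (if a = 0 then \<infinity> else enat (multiplicity (int p) a))"

definition vec_val :: "nat \<Rightarrow> int ^ 'n::finite \<Rightarrow> enat" where
  "vec_val p P = Min (range (\<lambda>i. int_val p (P $ i)))"

definition globally_visible_at :: "(real \<Rightarrow> real ^ 'n) \<Rightarrow> real \<Rightarrow> bool" where
  "globally_visible_at \<phi> t \<longleftrightarrow> \<not> (\<exists>s. 0 < s \<and> s < t \<and> \<phi> s \<in> range real_vec_of_int)"

definition padically_visible_at ::
    "nat \<Rightarrow> (real \<Rightarrow> real ^ 'n::finite) \<Rightarrow> real \<Rightarrow> bool" where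
  "padically_visible_at p \<phi> t \<longleftrightarrow>
     (\<forall>s P Q. 0 < s \<and> s < t \<and> \<phi> t = real_vec_of_int P \<and> \<phi> s = real_vec_of_int Q
        \<longrightarrow> vec_val p P \<le> vec_val p Q)"

definition globally_visible ::
    "'n::finite qpoly set \<Rightarrow> (real \<Rightarrow> real ^ 'n) set \<Rightarrow> (int ^ 'n) set" where
  "globally_visible F Y =
     {P \<in> branch_locus F. \<exists>\<phi>\<in>Y. \<exists>t>0. \<phi> t = real_vec_of_int P \<and> globally_visible_at \<phi> t}"

definition padically_visible ::
    "nat \<Rightarrow> 'n::finite qpoly set \<Rightarrow> (real \<Rightarrow> real ^ 'n) set \<Rightarrow> (int ^ 'n) set" where
  "padically_visible p F Y =
     {P \<in> branch_locus F. \<exists>\<phi>\<in>Y. \<exists>t>0. \<phi> t = real_vec_of_int P \<and> padically_visible_at p \<phi> t}"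


section \<open>Counting functions and densities\<close>

definition branch_locus_upto :: "'n::finite qpoly set \<Rightarrow> real \<Rightarrow> (int ^ 'n) set" where
  "branch_locus_upto F X = {P \<in> branch_locus F. of_int (height P) \<le> X}"

definition branch_count :: "'n::finite qpoly set \<Rightarrow> real \<Rightarrow> nat" where
  "branch_count F X = card (branch_locus_upto F X)"

definition primitive_count :: "'n::finite qpoly set \<Rightarrow> real \<Rightarrow> nat" where
  "primitive_count F X = card {P \<in> branch_locus_upto F X. Gcd (range (\<lambda>i. P $ i)) = 1}"

definition density_quotient ::
    "'n::finite qpoly set \<Rightarrow> (int ^ 'n) set \<Rightarrow> real \<Rightarrow> real" where
  "density_quotient F S X = real (card (S \<inter> branch_locus_upto F X)) / real (branch_count F X)"

definition has_relative_density ::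
    "'n::finite qpoly set \<Rightarrow> (int ^ 'n) set \<Rightarrow> real \<Rightarrow> bool" where
  "has_relative_density F S d \<longleftrightarrow> (density_quotient F S \<longlongrightarrow> d) at_top"

text \<open>Only meaningful if the limit exists, i.e. together with \<^const>\<open>has_relative_density\<close>.\<close>

definition relative_density :: "'n::finite qpoly set \<Rightarrow> (int ^ 'n) set \<Rightarrow> real" where
  "relative_density F S = Lim at_top (density_quotient F S)"

definition has_euler_product :: "(nat \<Rightarrow> real) \<Rightarrow> real \<Rightarrow> bool" where
  "has_euler_product f L \<longleftrightarrow> (\<lambda>Y. \<Prod>p | prime p \<and> p \<le> Y. f p) \<longlonglongrightarrow> L"

text \<open>The Riemann zeta function at real arguments \<open>s > 1\<close>, where its Dirichlet series converges.\<close>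

definition real_zeta :: "real \<Rightarrow> real" where
  "real_zeta s = suminf (\<lambda>k. 1 / real (Suc k) powr s)"


section \<open>Consistency of the definitions\<close>

lemma has_relative_density_imp_eq:
  "has_relative_density F S d \<Longrightarrow> relative_density F S = d"
  unfolding has_relative_density_def relative_density_def by (rule tendsto_Lim) simp_all

lemma finite_branch_locus_upto: "finite (branch_locus_upto (F :: 'n::finite qpoly set) X)"
proof -
  define B where "B = {P :: int ^ 'n. \<forall>i. P $ i \<in> {0..\<lfloor>X\<rfloor>}}"
  have "branch_locus_upto F X \<subseteq> B"
  proof
    fix P assume P: "P \<in> branch_locus_upto F X"
    show "P \<in> B" unfolding B_def
    proof (intro CollectI allI)
      fix i
      have "\<bar>P $ i\<bar> \<le> height P" unfolding height_def by (rule Max_ge) auto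
      moreover have "height P \<le> \<lfloor>X\<rfloor>" "P $ i > 0"
        using P by (auto simp: branch_locus_upto_def branch_locus_def le_floor_iff)
      ultimately show "P $ i \<in> {0..\<lfloor>X\<rfloor>}" by auto
    qed
  qed
  moreover have "B \<subseteq> vec_lambda ` (UNIV \<rightarrow>\<^sub>E {0..\<lfloor>X\<rfloor>})"
  proof
    fix P assume "P \<in> B"
    then have "vec_nth P \<in> UNIV \<rightarrow>\<^sub>E {0..\<lfloor>X\<rfloor>}" by (auto simp: B_def)
    then show "P \<in> vec_lambda ` (UNIV \<rightarrow>\<^sub>E {0..\<lfloor>X\<rfloor>})" by (metis image_eqI vec_nth_inverse)
  qed
  moreover have "finite (vec_lambda ` ((UNIV :: 'n set) \<rightarrow>\<^sub>E {0..\<lfloor>X\<rfloor>}))"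
    by (intro finite_imageI finite_PiE) auto
  ultimately show ?thesis by (meson finite_subset)
qed

lemma qpoly_eval_scale:
  fixes f :: "'n::finite qpoly"
  assumes "homogeneous_qpoly f"
  shows "\<exists>d. \<forall>q x. qpoly_eval f (q *s x) = q ^ d * qpoly_eval f x"
proof -
  obtain d where d: "\<And>m. m \<in> Poly_Mapping.keys f \<Longrightarrow> (\<Sum>i\<in>UNIV. Poly_Mapping.lookup m i) = d"
    using assms unfolding homogeneous_qpoly_def by blast
  have "qpoly_eval f (q *s x) = q ^ d * qpoly_eval f x" for q x
    unfolding qpoly_eval_def sum_distrib_left
    by (rule sum.cong) (auto simp: power_mult_distrib prod.distrib d simp flip: power_sum)
  then show ?thesis by blast
qed

lemma positive_rational_points_scale:
  assumes "\<forall>f\<in>F. homogeneous_qpoly f" "x \<in> positive_rational_points F" "q > 0"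
  shows "q *s x \<in> positive_rational_points F"
proof -
  have "qpoly_eval f (q *s x) = 0" if "f \<in> F" for f
    using qpoly_eval_scale[of f] assms that
    by (auto simp: positive_rational_points_def rational_points_def)
  then show ?thesis using assms by (auto simp: positive_rational_points_def rational_points_def)
qed

lemma equiv_ray_rel: "equiv (positive_rational_points F) (ray_rel F)"
proof (rule equivI)
  show "ray_rel F \<subseteq> positive_rational_points F \<times> positive_rational_points F"
    by (auto simp: ray_rel_def)
  show "refl_on (positive_rational_points F) (ray_rel F)"
    by (auto simp: ray_rel_def refl_on_def intro!: exI[of _ 1])
  show "sym (ray_rel F)"
  proof (rule symI)
    fix u v assume "(u, v) \<in> ray_rel F"
    then obtain q where q: "u \<in> positive_rational_points F" "v \<in> positive_rational_points F"
      "q > 0" "u = q *s v" by (auto simp: ray_rel_def)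
    have "v = inverse q *s u" using q by (simp add: vec_eq_iff)
    then show "(v, u) \<in> ray_rel F" using q by (auto simp: ray_rel_def intro!: exI[of _ "inverse q"])
  qed
  show "trans (ray_rel F)"
  proof (rule transI)
    fix u v w assume "(u, v) \<in> ray_rel F" "(v, w) \<in> ray_rel F"
    then obtain q r where q: "u \<in> positive_rational_points F" "w \<in> positive_rational_points F"
      "q > 0" "r > 0" "u = q *s v" "v = r *s w" by (auto simp: ray_rel_def)
    then show "(u, w) \<in> ray_rel F"
      by (auto simp: ray_rel_def vector_smult_assoc intro!: exI[of _ "q * r"])
  qed
qed

text \<open>The branch locus consists exactly of the integral points lying on the branches.\<close>

lemma branch_locus_eq:
  fixes F :: "'n::finite qpoly set"
  assumes hom: "\<forall>f\<in>F. homogeneous_qpoly f" and Y: "rational_ray_datum F Y"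
  shows "branch_locus F = {P. \<exists>\<phi>\<in>Y. \<exists>t>0. \<phi> t = real_vec_of_int P}"
proof -
  let ?A = "positive_rational_points F // ray_rel F"
  obtain rep where rep: "\<And>C. C \<in> ?A \<Longrightarrow> rep C \<in> C"
    and Y: "Y = (\<lambda>C. ray_branch (rep C)) ` ?A"
    using Y unfolding rational_ray_datum_def by blast
  show ?thesis
  proof (intro set_eqI iffI)
    fix P assume "P \<in> branch_locus F"
    then have P: "rat_vec P \<in> positive_rational_points F"
      by (auto simp: branch_locus_def integral_points_def positive_rational_points_def rat_vec_def)
    define C where "C = ray_rel F `` {rat_vec P}"
    have C: "C \<in> ?A" using P by (auto simp: C_def quotient_def)
    from rep[OF C] obtain q where q: "q > 0" "rat_vec P = q *s rep C"
      by (auto simp: C_def ray_rel_def)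
    have "ray_branch (rep C) (of_rat q) = real_vec_of_int P"
    proof (rule iffD2[OF vec_eq_iff], rule allI)
      fix i
      have "of_int (P $ i) = q * rep C $ i"
        using q(2) by (auto simp: vec_eq_iff rat_vec_def)
      then have "of_rat (of_int (P $ i)) = (of_rat (q * rep C $ i) :: real)" by simp
      then show "ray_branch (rep C) (of_rat q) $ i = real_vec_of_int P $ i"
        by (simp add: ray_branch_def real_vec_of_rat_def real_vec_of_int_def of_rat_mult)
    qed
    then show "P \<in> {P. \<exists>\<phi>\<in>Y. \<exists>t>0. \<phi> t = real_vec_of_int P}"
      using C q(1) unfolding Y by (auto intro!: bexI[of _ C] exI[of _ "of_rat q"])
  next
    fix P assume "P \<in> {P. \<exists>\<phi>\<in>Y. \<exists>t>0. \<phi> t = real_vec_of_int P}"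
    then obtain C t where C: "C \<in> ?A" "t > 0" "ray_branch (rep C) t = real_vec_of_int P"
      unfolding Y by auto
    have v: "rep C \<in> positive_rational_points F"
      using rep[OF C(1)] C(1) in_quotient_imp_subset[OF equiv_ray_rel] by blast
    have eq: "t * of_rat (rep C $ i) = of_int (P $ i)" for i
      using C(3) by (auto simp: vec_eq_iff ray_branch_def real_vec_of_rat_def real_vec_of_int_def)
    have pos: "rep C $ i > 0" for i using v by (auto simp: positive_rational_points_def)
    obtain i0 :: 'n where True by simp
    define q where "q = of_int (P $ i0) / rep C $ i0"
    have "t = of_int (P $ i0) / of_rat (rep C $ i0)"
      using eq[of i0] pos[of i0] by (simp add: field_simps)
    then have t: "t = of_rat q" by (simp add: q_def of_rat_divide)
    then have q: "q > 0" using C(2) by simp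
    have "rat_vec P $ i = (q *s rep C) $ i" for i
    proof -
      have "(of_rat (q * rep C $ i) :: real) = of_rat (of_int (P $ i))"
        using eq[of i] t by (simp add: of_rat_mult)
      then have "q * rep C $ i = of_int (P $ i)" by (simp only: of_rat_eq_iff)
      then show ?thesis by (simp add: rat_vec_def)
    qed
    then have "rat_vec P = q *s rep C" by (simp add: vec_eq_iff)
    then have "rat_vec P \<in> positive_rational_points F"
      using positive_rational_points_scale[OF hom v q] by simp
    then show "P \<in> branch_locus F"
      by (auto simp: branch_locus_def integral_points_def positive_rational_points_def rat_vec_def)
  qed
qed

end

theory Submission
  imports Defs "HOL-Real_Asymp.Real_Asymp"
begin

text \<open>
  The whole statement is governed by the content of an integral point, the gcd \<open>g\<close> of its
  coordinates. On the ray through a point \<open>P\<close> of the branch locus the integral points below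
  \<open>P\<close> are the \<open>(m/g) P\<close> with \<open>0 < m < g\<close>, so \<open>P\<close> is globally visible iff \<open>g = 1\<close>. It is
  \<open>p\<close>-adically visible iff \<open>p\<close> does not divide \<open>g\<close>: if \<open>p\<close> divides \<open>g\<close> then \<open>P/p\<close> is an
  earlier point of strictly smaller valuation, and otherwise \<open>v\<^sub>p(P) = 0\<close> is minimal
  (\<open>globally_visible_eq\<close>, \<open>padically_visible_eq\<close>).

  The branch locus is stable under multiplication by \<open>k\<close> and under division by divisors of the
  content, and heights scale accordingly. With \<open>N\<close> the count of all branch points and \<open>N\<^sub>1\<close> that of
  the primitive ones, sorting by content gives
  \<open>N(X) = (\<Sum>k\<le>X. N\<^sub>1(X/k))\<close>, while exactly \<open>N(X/p)\<close> points up to height \<open>X\<close> fail to be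
  \<open>p\<close>-adically visible (\<open>branch_count_eq_sum\<close>, \<open>card_dvd_content\<close>).

  If \<open>N\<^sub>1(X) \<sim> c X\<^sup>\<alpha> (log X)\<^sup>\<beta>\<close> with \<open>\<alpha> > 1\<close>, the \<open>k\<close>-th term divided by
  \<open>X\<^sup>\<alpha> (log X)\<^sup>\<beta>\<close> tends to \<open>c k\<^sup>-\<^sup>\<alpha>\<close> and is dominated by a constant multiple of \<open>k\<^sup>-\<^sup>\<alpha>\<close>, so
  Tannery's theorem yields \<open>c \<zeta>(\<alpha>)\<close> (\<open>dilate_sum_asymp_gt_1\<close>). For \<open>\<alpha> = 1\<close> no range
  of \<open>k\<close> dominates and the sum behaves like
  \<open>c X (\<Sum>k\<le>X. log(X/k)\<^sup>\<beta> / k)\<close>, where the sum approximates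
  the integral of \<open>y\<^sup>\<beta>\<close> over \<open>[0, log X]\<close>; this produces the additional factor
  \<open>log X / (\<beta> + 1)\<close> (\<open>dilate_sum_asymp_1\<close>).
  In both cases \<open>N(X/p)/N(X)\<close> tends to \<open>p\<^sup>-\<^sup>\<alpha>\<close>, which gives the local densities, and \<open>N\<^sub>1/N\<close>
  gives the global one.

  What remains is the Euler product. Sieving the series of \<open>\<zeta>(s)\<close> by the primes up to \<open>Y\<close>
  leaves only \<open>1\<close> and integers above \<open>Y\<close>, so the partial products of \<open>1 - p\<^sup>-\<^sup>s\<close> tend to
  \<open>1/\<zeta>(s)\<close> for \<open>s > 1\<close> (\<open>euler_product_real_zeta\<close>). They dominate those of \<open>1 - 1/p\<close> for
  every \<open>s > 1\<close>, and \<open>\<zeta>(s)\<close> is unbounded as \<open>s\<close> decreases to \<open>1\<close>, so the latter tend to \<open>0\<close>.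
\<close>

section \<open>Content and height of integral points\<close>

definition content :: "int ^ 'n::finite \<Rightarrow> int" where
  "content P = Gcd (range (\<lambda>i. P $ i))"

lemma content_scale:
  assumes "k \<ge> 0" shows "content (k *s P) = k * content P"
proof -
  have "range (\<lambda>i. (k *s P) $ i) = (*) k ` range (\<lambda>i. P $ i)" by (auto simp: image_image)
  then show ?thesis using assms by (simp add: content_def Gcd_mult abs_mult)
qed

lemma content_dvd: "content P dvd P $ i"
  by (simp add: content_def Gcd_dvd)

lemma dvd_content_iff: "d dvd content P \<longleftrightarrow> (\<forall>i. d dvd P $ i)"
  by (auto simp: content_def dvd_Gcd_iff)

lemma content_pos:
  assumes "P $ i > 0" shows "content P > 0"
proof -
  have "content P \<noteq> 0" using content_dvd[of P i] assms by auto
  moreover have "content P \<ge> 0" by (simp add: content_def)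
  ultimately show ?thesis by simp
qed

lemma dvd_content_imp_scale:
  assumes "d dvd content P" obtains Q where "P = d *s Q"
proof
  show "P = d *s (\<chi> i. P $ i div d)"
    using assms by (simp add: vec_eq_iff dvd_content_iff)
qed

lemma height_scale:
  assumes "k \<ge> 0" shows "height (k *s P) = k * height P"
proof -
  have "mono (\<lambda>x. k * x)" using assms by (auto intro!: monoI mult_left_mono)
  from mono_Max_commute[OF this, of "range (\<lambda>i. \<bar>P $ i\<bar>)"] show ?thesis
    using assms by (simp add: height_def image_image abs_mult)
qed

section \<open>Visibility in terms of the content\<close>

text \<open>Eliminating the representative \<open>v\<close>: a known integral point \<open>P\<close> on the branch fixes it up to
  the parameter, and the remaining condition relates integer coordinates only.\<close>

lemma ray_branch_eq_iff:
  assumes t: "t > 0" "ray_branch v t = real_vec_of_int P"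
  shows "ray_branch v s = real_vec_of_int Q \<longleftrightarrow> (\<forall>i. s * real_of_int (P $ i) = t * real_of_int (Q $ i))"
proof -
  have v: "real_of_int (P $ i) = t * real_of_rat (v $ i)" for i
    using t(2) by (simp add: vec_eq_iff ray_branch_def real_vec_of_int_def real_vec_of_rat_def)
  show ?thesis unfolding v
    using t(1) by (auto simp: vec_eq_iff ray_branch_def real_vec_of_int_def real_vec_of_rat_def)
qed

lemma ray_branch_divide:
  assumes t: "t > 0" "ray_branch v t = real_vec_of_int P" and k: "k > 0" and P: "P = k *s Q"
  shows "ray_branch v (t / real_of_int k) = real_vec_of_int Q"
  using k by (subst ray_branch_eq_iff[OF t]) (auto simp: P)

text \<open>A content \<open>g > 1\<close> is witnessed by the earlier point \<open>P/g\<close>. Conversely let \<open>Q = r P\<close> be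
  integral with \<open>0 < r < 1\<close>. Then \<open>P\<^sub>i Q = Q\<^sub>i P\<close> for every coordinate \<open>i\<close>, and comparing contents
  when \<open>P\<close> is primitive shows that \<open>P\<^sub>i\<close> divides \<open>Q\<^sub>i\<close>, although \<open>0 < Q\<^sub>i < P\<^sub>i\<close>.\<close>

lemma globally_visible_at_ray_branch:
  fixes P :: "int ^ 'n::finite"
  assumes t: "t > 0" "ray_branch v t = real_vec_of_int P" and P: "\<And>i. P $ i > 0"
  shows "globally_visible_at (ray_branch v) t \<longleftrightarrow> content P = 1"
proof
  assume vis: "globally_visible_at (ray_branch v) t"
  show "content P = 1"
  proof (rule ccontr)
    assume "content P \<noteq> 1"
    then have g: "content P > 1" using content_pos[OF P] by (simp add: order.strict_iff_order)
    obtain Q where Q: "P = content P *s Q" using dvd_content_imp_scale[OF dvd_refl] .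
    from ray_branch_divide[OF t _ Q] g
    have "ray_branch v (t / real_of_int (content P)) \<in> range real_vec_of_int" by simp
    moreover have "0 < t / real_of_int (content P)" "t / real_of_int (content P) < t"
      using t(1) g by (auto simp: field_simps)
    ultimately show False using vis unfolding globally_visible_at_def by blast
  qed
next
  assume g: "content P = 1"
  show "globally_visible_at (ray_branch v) t"
    unfolding globally_visible_at_def
  proof
    assume "\<exists>s>0. s < t \<and> ray_branch v s \<in> range real_vec_of_int"
    then obtain s Q where s: "0 < s" "s < t" "ray_branch v s = real_vec_of_int Q" by auto
    have eq: "s * real_of_int (P $ i) = t * real_of_int (Q $ i)" for i
      using ray_branch_eq_iff[OF t] s(3) by blast
    obtain i :: 'n where True by simp
    have "0 < t * real_of_int (Q $ i)" using eq[of i] s P[of i] by (metis mult_pos_pos of_int_0_less_iff)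
    then have Qi: "Q $ i > 0" using t(1) by (simp add: zero_less_mult_iff)
    have "t * real_of_int (Q $ i) < t * real_of_int (P $ i)"
      unfolding eq[symmetric] using s P[of i] by (intro mult_strict_right_mono) auto
    then have less: "Q $ i < P $ i" using t(1) by simp
    have "P $ i * Q $ j = Q $ i * P $ j" for j
    proof -
      have "t * (real_of_int (P $ i) * real_of_int (Q $ j)) = real_of_int (P $ i) * (s * real_of_int (P $ j))"
        using eq[of j] by (simp add: mult_ac)
      also have "\<dots> = t * (real_of_int (Q $ i) * real_of_int (P $ j))"
        using eq[of i] by (metis mult.assoc mult.commute)
      finally have "real_of_int (P $ i * Q $ j) = real_of_int (Q $ i * P $ j)" using t(1) by simp
      then show ?thesis by (simp only: of_int_eq_iff)
    qed
    then have "P $ i *s Q = Q $ i *s P" by (simp add: vec_eq_iff)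
    then have "P $ i * content Q = Q $ i"
      using content_scale[of "P $ i" Q] content_scale[of "Q $ i" P] g Qi P[of i] by simp
    moreover have "P $ i * 1 \<le> P $ i * content Q"
      using content_pos[OF Qi] P[of i] by (intro mult_left_mono) auto
    ultimately show False using less by simp
  qed
qed

lemma vec_val_eq_0:
  assumes p: "prime p" and "\<not> int p dvd content P"
  shows "vec_val p P = 0"
proof -
  obtain i where i: "\<not> int p dvd P $ i" using assms by (auto simp: dvd_content_iff)
  then have "int_val p (P $ i) = 0"
    by (auto simp: int_val_def not_dvd_imp_multiplicity_0 zero_enat_def)
  then have "vec_val p P \<le> 0" unfolding vec_val_def by (metis Min_le finite finite_imageI rangeI)
  then show ?thesis by simp
qed

lemma vec_val_less_scale:
  fixes Q :: "int ^ 'n::finite"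
  assumes p: "prime p" and Q: "\<And>i. Q $ i \<noteq> 0"
  shows "vec_val p Q < vec_val p (int p *s Q)"
proof -
  have "vec_val p (int p *s Q) \<in> range (\<lambda>i. int_val p ((int p *s Q) $ i))"
    unfolding vec_val_def by (rule Min_in) auto
  then obtain i where i: "vec_val p (int p *s Q) = int_val p (int p * Q $ i)" by auto
  have "vec_val p Q \<le> int_val p (Q $ i)" unfolding vec_val_def by (rule Min_le) auto
  also have "\<dots> < int_val p (int p * Q $ i)"
  proof -
    have "prime (int p)" using p by simp
    then have "multiplicity (int p) (int p * Q $ i) = Suc (multiplicity (int p) (Q $ i))"
      using Q[of i] by (intro multiplicity_times_same) (auto dest: not_prime_unit)
    then show ?thesis using p Q[of i] by (auto simp: int_val_def)
  qed
  finally show ?thesis using i by simp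
qed

lemma padically_visible_at_ray_branch:
  fixes P :: "int ^ 'n::finite"
  assumes t: "t > 0" "ray_branch v t = real_vec_of_int P" and P: "\<And>i. P $ i > 0"
    and p: "prime p"
  shows "padically_visible_at p (ray_branch v) t \<longleftrightarrow> \<not> int p dvd content P"
proof
  assume vis: "padically_visible_at p (ray_branch v) t"
  show "\<not> int p dvd content P"
  proof
    assume "int p dvd content P"
    then obtain Q where Q: "P = int p *s Q" by (rule dvd_content_imp_scale)
    have p1: "real p > 1" using prime_gt_1_nat[OF p] by simp
    have "ray_branch v (t / real p) = real_vec_of_int Q"
      using ray_branch_divide[OF t _ Q] p1 by simp
    moreover have "0 < t / real p" "t / real p < t" using t(1) p1 by (auto simp: field_simps)
    ultimately have "vec_val p P \<le> vec_val p Q"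
      using vis t(2) unfolding padically_visible_at_def by blast
    moreover have "vec_val p Q < vec_val p P" unfolding Q
    proof (rule vec_val_less_scale[OF p])
      fix i show "Q $ i \<noteq> 0" using P[of i] Q by auto
    qed
    ultimately show False by simp
  qed
next
  assume "\<not> int p dvd content P"
  then have P0: "vec_val p P = 0" by (rule vec_val_eq_0[OF p])
  have inj: "Q = P" if "real_vec_of_int P = real_vec_of_int Q" for Q :: "int ^ 'n"
    using that by (simp add: real_vec_of_int_def vec_eq_iff)
  show "padically_visible_at p (ray_branch v) t"
    unfolding padically_visible_at_def t(2) using inj P0 by auto
qed

text \<open>Both visibility sets ask for a suitable branch through \<open>P\<close> and a suitable parameter on it.
  Every branch point lies on some branch, so a notion of visibility that depends on \<open>P\<close> alone
  determines the set, whichever representatives were chosen.\<close>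

lemma branch_point_visibility:
  assumes hom: "\<forall>f\<in>F. homogeneous_qpoly f" and Y: "rational_ray_datum F Y"
    and vis: "\<And>v t P. t > 0 \<Longrightarrow> ray_branch v t = real_vec_of_int P \<Longrightarrow> (\<And>i. P $ i > 0) \<Longrightarrow>
                V (ray_branch v) t \<longleftrightarrow> G P"
  shows "{P \<in> branch_locus F. \<exists>\<phi>\<in>Y. \<exists>t>0. \<phi> t = real_vec_of_int P \<and> V \<phi> t} =
         {P \<in> branch_locus F. G P}"
proof -
  have "(\<exists>\<phi>\<in>Y. \<exists>t>0. \<phi> t = real_vec_of_int P \<and> V \<phi> t) \<longleftrightarrow> G P" if P: "P \<in> branch_locus F" for P
  proof -
    have pos: "P $ i > 0" for i using P by (simp add: branch_locus_def)
    have ex: "\<exists>\<phi>\<in>Y. \<exists>t>0. \<phi> t = real_vec_of_int P" using P branch_locus_eq[OF hom Y] by blast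
    have "V \<phi> t \<longleftrightarrow> G P" if "\<phi> \<in> Y" "t > 0" "\<phi> t = real_vec_of_int P" for \<phi> t
    proof -
      obtain v where "\<phi> = ray_branch v" using Y \<open>\<phi> \<in> Y\<close> unfolding rational_ray_datum_def by auto
      then show ?thesis using vis[of t v P] that pos by auto
    qed
    then show ?thesis using ex by blast
  qed
  then show ?thesis by blast
qed

lemma globally_visible_eq:
  assumes "\<forall>f\<in>F. homogeneous_qpoly f" "rational_ray_datum F Y"
  shows "globally_visible F Y = {P \<in> branch_locus F. content P = 1}"
  unfolding globally_visible_def
  using globally_visible_at_ray_branch
  by (intro branch_point_visibility[where V = globally_visible_at, OF assms]) blast

lemma padically_visible_eq:
  assumes "\<forall>f\<in>F. homogeneous_qpoly f" "rational_ray_datum F Y" "prime p"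
  shows "padically_visible p F Y = {P \<in> branch_locus F. \<not> int p dvd content P}"
  unfolding padically_visible_def
  using padically_visible_at_ray_branch[OF _ _ _ assms(3)]
  by (intro branch_point_visibility[where V = "padically_visible_at p", OF assms(1,2)]) blast

section \<open>Counting branch points by content\<close>

text \<open>Homogeneity makes the rational points a cone; division by \<open>k\<close> is multiplication by the
  rational number \<open>1/k\<close>.\<close>

lemma branch_locus_scale_iff:
  fixes F :: "'n::finite qpoly set"
  assumes hom: "\<forall>f\<in>F. homogeneous_qpoly f" and k: "k > 0"
  shows "k *s P \<in> branch_locus F \<longleftrightarrow> P \<in> branch_locus F"
proof -
  have eq: "Q \<in> branch_locus F \<longleftrightarrow> rat_vec Q \<in> positive_rational_points F" for Q
    by (auto simp: branch_locus_def integral_points_def positive_rational_points_def rat_vec_def)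
  have "rat_vec (k *s P) = of_int k *s rat_vec P" by (simp add: rat_vec_def vec_eq_iff)
  moreover have "rat_vec P = inverse (of_int k) *s (of_int k *s rat_vec P)"
    using k by (simp add: vec_eq_iff)
  ultimately show ?thesis
    unfolding eq using positive_rational_points_scale[OF hom] k
    by (metis of_int_0_less_iff positive_imp_inverse_positive)
qed

lemma branch_locus_upto_scale_iff:
  fixes F :: "'n::finite qpoly set"
  assumes hom: "\<forall>f\<in>F. homogeneous_qpoly f" and k: "k > 0"
  shows "int k *s P \<in> branch_locus_upto F X \<longleftrightarrow> P \<in> branch_locus_upto F (X / real k)"
  using k by (simp add: branch_locus_upto_def branch_locus_scale_iff[OF hom] height_scale field_simps)

text \<open>Multiplication by \<open>k\<close> is a bijection from the branch points up to height \<open>X/k\<close> onto those up to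
  height \<open>X\<close> whose content is divisible by \<open>k\<close>. The predicate \<open>T\<close> serves to restrict it to the
  points of content exactly \<open>k\<close>.\<close>

lemma card_multiples:
  fixes F :: "'n::finite qpoly set"
  assumes hom: "\<forall>f\<in>F. homogeneous_qpoly f" and k: "k > 0"
  shows "card {P \<in> branch_locus_upto F X. int k dvd content P \<and> T P} =
         card {Q \<in> branch_locus_upto F (X / real k). T (int k *s Q)}"
proof -
  have "{P \<in> branch_locus_upto F X. int k dvd content P \<and> T P} =
        (\<lambda>Q. int k *s Q) ` {Q \<in> branch_locus_upto F (X / real k). T (int k *s Q)}"
  proof (intro set_eqI iffI)
    fix P assume P: "P \<in> {P \<in> branch_locus_upto F X. int k dvd content P \<and> T P}"
    then obtain Q where "P = int k *s Q" using dvd_content_imp_scale by blast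
    with P show "P \<in> (\<lambda>Q. int k *s Q) ` {Q \<in> branch_locus_upto F (X / real k). T (int k *s Q)}"
      using branch_locus_upto_scale_iff[OF hom k] by blast
  qed (use k branch_locus_upto_scale_iff[OF hom k] in \<open>auto simp: content_scale\<close>)
  moreover have "inj_on (\<lambda>Q. int k *s Q) S" for S :: "(int ^ 'n) set"
    using k by (auto simp: inj_on_def vec_eq_iff)
  ultimately show ?thesis by (simp add: card_image)
qed

lemma card_dvd_content:
  fixes F :: "'n::finite qpoly set"
  assumes "\<forall>f\<in>F. homogeneous_qpoly f" and "k > 0"
  shows "card {P \<in> branch_locus_upto F X. int k dvd content P} = branch_count F (X / real k)"
  using card_multiples[OF assms, where T = "\<lambda>_. True"] by (simp add: branch_count_def)

lemma card_content_eq: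
  fixes F :: "'n::finite qpoly set"
  assumes "\<forall>f\<in>F. homogeneous_qpoly f" and k: "k > 0"
  shows "card {P \<in> branch_locus_upto F X. content P = int k} = primitive_count F (X / real k)"
proof -
  have "{P \<in> branch_locus_upto F X. content P = int k} =
        {P \<in> branch_locus_upto F X. int k dvd content P \<and> content P = int k}" by auto
  also have "card \<dots> = card {Q \<in> branch_locus_upto F (X / real k). content (int k *s Q) = int k}"
    by (rule card_multiples[OF assms])
  also have "\<dots> = primitive_count F (X / real k)"
    using k by (simp add: content_scale primitive_count_def content_def[symmetric])
  finally show ?thesis .
qed

text \<open>The content of a branch point divides a positive coordinate, so it lies between \<open>1\<close> and the
  height; the points of content \<open>k\<close> are the \<open>k\<close>-multiples of primitive points.\<close>

lemma branch_count_eq_sum: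
  fixes F :: "'n::finite qpoly set"
  assumes hom: "\<forall>f\<in>F. homogeneous_qpoly f"
  shows "branch_count F X = (\<Sum>k=1..nat \<lfloor>X\<rfloor>. primitive_count F (X / real k))"
proof -
  have "branch_locus_upto F X = (\<Union>k\<in>{1..nat \<lfloor>X\<rfloor>}. {P \<in> branch_locus_upto F X. content P = int k})"
  proof (intro set_eqI iffI)
    fix P assume P: "P \<in> branch_locus_upto F X"
    obtain i :: 'n where True by simp
    have Pi: "P $ i > 0" using P by (simp add: branch_locus_upto_def branch_locus_def)
    have "content P \<le> P $ i" using content_dvd Pi by (rule zdvd_imp_le)
    also have "\<dots> \<le> height P" unfolding height_def
      by (rule order.trans[OF abs_ge_self Max_ge]) auto
    also have "height P \<le> \<lfloor>X\<rfloor>" using P by (simp add: branch_locus_upto_def le_floor_iff)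
    finally have "content P \<le> \<lfloor>X\<rfloor>" .
    then show "P \<in> (\<Union>k\<in>{1..nat \<lfloor>X\<rfloor>}. {P \<in> branch_locus_upto F X. content P = int k})"
      using P content_pos[OF Pi] by (auto intro!: bexI[of _ "nat (content P)"])
  qed auto
  then have "branch_count F X =
      card (\<Union>k\<in>{1..nat \<lfloor>X\<rfloor>}. {P \<in> branch_locus_upto F X. content P = int k})"
    unfolding branch_count_def by simp
  also have "\<dots> = (\<Sum>k=1..nat \<lfloor>X\<rfloor>. card {P \<in> branch_locus_upto F X. content P = int k})"
    by (rule card_UN_disjoint) (auto simp: finite_branch_locus_upto)
  also have "\<dots> = (\<Sum>k=1..nat \<lfloor>X\<rfloor>. primitive_count F (X / real k))"
    by (rule sum.cong) (auto simp: card_content_eq[OF hom])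
  finally show ?thesis .
qed

lemma mono_primitive_count: "mono (primitive_count F)"
  unfolding primitive_count_def
  by (intro monoI card_mono) (auto simp: branch_locus_upto_def intro: finite_subset[OF _ finite_branch_locus_upto])

lemma primitive_count_eq_0:
  fixes F :: "'n::finite qpoly set"
  assumes "X < 1" shows "primitive_count F X = 0"
proof -
  have "branch_locus_upto F X = {}"
  proof (rule equals0I)
    fix P assume P: "P \<in> branch_locus_upto F X"
    obtain i :: 'n where True by simp
    have "P $ i > 0" using P by (simp add: branch_locus_upto_def branch_locus_def)
    moreover have "P $ i \<le> height P" unfolding height_def
      by (rule order.trans[OF abs_ge_self Max_ge]) auto
    ultimately have "height P \<ge> 1" by simp
    then have "1 \<le> X" using P by (simp add: branch_locus_upto_def)
    with assms show False by simp
  qed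
  then show ?thesis by (simp add: primitive_count_def)
qed

section \<open>The real zeta function and its Euler product\<close>

lemma real_zeta_summable: "s > 1 \<Longrightarrow> summable (\<lambda>k. 1 / real (Suc k) powr s)"
  using summable_real_powr_iff[of "-s"]
  by (subst summable_Suc_iff) (simp add: powr_minus inverse_eq_divide)

lemma real_zeta_ge_partial_sum:
  assumes "s > 1"
  shows "(\<Sum>k<N. 1 / real (Suc k) powr s) \<le> real_zeta s"
  unfolding real_zeta_def using real_zeta_summable[OF assms] by (intro sum_le_suminf) auto

lemma real_zeta_ge_1: "s > 1 \<Longrightarrow> real_zeta s \<ge> 1"
  using real_zeta_ge_partial_sum[of s 1] by simp

text \<open>Sieving by one more prime \<open>p\<close> removes the numbers \<open>p n\<close> with \<open>n\<close> already coprime to \<open>A\<close>, and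
  their contribution is \<open>p\<^sup>-\<^sup>s\<close> times the current sum.\<close>

lemma sieved_zeta_has_sum:
  fixes A :: "nat set"
  assumes s: "s > 1" and "finite A" and "\<And>p. p \<in> A \<Longrightarrow> prime p"
  shows "((\<lambda>n. 1 / real n powr s) has_sum real_zeta s * (\<Prod>p\<in>A. 1 - real p powr (-s)))
           {n. n > 0 \<and> (\<forall>p\<in>A. \<not> p dvd n)}"
  using assms(2,3)
proof (induction rule: finite_induct)
  case empty
  have "((\<lambda>k. 1 / real (Suc k) powr s) has_sum real_zeta s) UNIV"
    unfolding real_zeta_def using summable_sums[OF real_zeta_summable[OF s]]
    by (rule sums_nonneg_imp_has_sum) simp
  then have "((\<lambda>n. 1 / real n powr s) has_sum real_zeta s) (range Suc)"
    by (subst has_sum_reindex) (auto simp: o_def)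
  moreover have "range Suc = {n. n > 0}" by (auto simp: image_iff gr0_conv_Suc)
  ultimately show ?case by simp
next
  case (insert p A)
  let ?f = "\<lambda>n. 1 / real n powr s"
  let ?S = "\<lambda>A. {n::nat. n > 0 \<and> (\<forall>p\<in>A. \<not> p dvd n)}"
  let ?z = "real_zeta s * (\<Prod>p\<in>A. 1 - real p powr (-s))"
  have p: "prime p" "p > 0" using insert.prems by (auto intro: prime_gt_0_nat)
  have IH: "(?f has_sum ?z) (?S A)" using insert by auto
  have mem: "p * n \<in> ?S A \<longleftrightarrow> n \<in> ?S A" for n
  proof -
    have "q dvd p * n \<longleftrightarrow> q dvd n" if "q \<in> A" for q
    proof -
      have "prime q" "q \<noteq> p" using that insert by auto
      then show ?thesis using p by (auto simp: prime_dvd_mult_iff dest: primes_dvd_imp_eq)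
    qed
    then show ?thesis using p by auto
  qed
  have "((\<lambda>n. real p powr (-s) * ?f n) has_sum real p powr (-s) * ?z) (?S A)"
    by (rule has_sum_cmult_right[OF IH])
  also have "(\<lambda>n. real p powr (-s) * ?f n) = ?f \<circ> (\<lambda>n. p * n)"
    by (auto simp: powr_mult powr_minus field_simps)
  finally have "(?f has_sum real p powr (-s) * ?z) ((\<lambda>n. p * n) ` ?S A)"
    using p by (subst has_sum_reindex) (auto simp: inj_on_def o_def)
  moreover have "(\<lambda>n. p * n) ` ?S A \<subseteq> ?S A" using mem by blast
  ultimately have "(?f has_sum ?z - real p powr (-s) * ?z) (?S A - (\<lambda>n. p * n) ` ?S A)"
    using IH by (intro has_sum_Diff) auto
  moreover have "?S A - (\<lambda>n. p * n) ` ?S A = ?S (insert p A)"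
  proof -
    have "n \<in> (\<lambda>n. p * n) ` ?S A \<longleftrightarrow> p dvd n \<and> n \<in> ?S A" for n
    proof
      assume "p dvd n \<and> n \<in> ?S A"
      then obtain m where "n = p * m" "p * m \<in> ?S A" by (metis dvdE)
      then show "n \<in> (\<lambda>n. p * n) ` ?S A" unfolding mem by blast
    next
      assume "n \<in> (\<lambda>n. p * n) ` ?S A"
      then obtain m where "n = p * m" "m \<in> ?S A" by blast
      then show "p dvd n \<and> n \<in> ?S A" using mem[of m] by auto
    qed
    then show ?thesis by blast
  qed
  ultimately show ?case using insert.hyps by (simp add: algebra_simps)
qed

text \<open>A number that survives the sieve by all primes up to \<open>Y\<close> is \<open>1\<close> or exceeds \<open>Y\<close>. The sifted sum
  \<open>\<zeta>(s) (\<Prod>p\<le>Y. 1 - p\<^sup>-\<^sup>s)\<close> is therefore at least \<open>1\<close> and at most \<open>1\<close> plus a tail of the series.\<close>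

lemma euler_product_real_zeta:
  assumes s: "s > 1"
  shows "has_euler_product (\<lambda>p. 1 - real p powr (-s)) (1 / real_zeta s)"
proof -
  let ?f = "\<lambda>n. 1 / real n powr s"
  let ?P = "\<lambda>Y::nat. \<Prod>p | prime p \<and> p \<le> Y. 1 - real p powr (-s)"
  let ?S = "\<lambda>Y::nat. {n. n > 0 \<and> (\<forall>p\<in>{p. prime p \<and> p \<le> Y}. \<not> p dvd n)}"
  let ?t = "\<lambda>Y::nat. \<Sum>k<Y. 1 / real (Suc k) powr s"
  have sieve: "(?f has_sum real_zeta s * ?P Y) (?S Y)" for Y
    by (rule sieved_zeta_has_sum[OF s]) auto
  have all: "(?f has_sum real_zeta s) {n. n > 0}"
    using sieved_zeta_has_sum[OF s, of "{}"] by simp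
  have lower: "1 \<le> real_zeta s * ?P Y" for Y
  proof (rule has_sum_mono_neutral[OF _ sieve])
    show "((\<lambda>n. 1 :: real) has_sum 1) {1::nat}" using has_sum_finite[of "{1::nat}" "\<lambda>_. 1::real"] by simp
  qed (auto simp: prime_nat_iff)
  have upper: "real_zeta s * ?P Y \<le> real_zeta s - ?t Y + 1" if "Y \<ge> 1" for Y
  proof (rule has_sum_mono_neutral[OF sieve])
    have "(?f has_sum real_zeta s - sum ?f {2..Y}) ({n. n > 0} - {2..Y})"
      by (rule has_sum_Diff[OF all has_sum_finite]) auto
    moreover have "sum ?f {2..Y} = ?t Y - 1"
    proof -
      have "?t Y = sum ?f {1..Y}"
        by (rule sum.reindex_bij_witness[of _ "\<lambda>k. k - 1" Suc]) auto
      also have "{1..Y} = insert 1 {2..Y}" using that by auto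
      finally show ?thesis by simp
    qed
    ultimately show "(?f has_sum real_zeta s - ?t Y + 1) ({n. n > 0} - {2..Y})"
      by (simp only: diff_diff_eq2) (simp add: algebra_simps)
    fix n assume n: "n \<in> ?S Y - ({n. n > 0} - {2..Y})"
    then have "n \<noteq> 1" "n \<le> Y" "n > 0" by auto
    then obtain p where "prime p" "p dvd n" using prime_factor_nat by blast
    moreover from this have "p \<le> Y" using \<open>n \<le> Y\<close> \<open>n > 0\<close> by (meson dvd_imp_le order.trans)
    ultimately show "?f n \<le> 0" using n by auto
  qed auto
  have "?t \<longlonglongrightarrow> real_zeta s"
    unfolding real_zeta_def by (rule summable_LIMSEQ[OF real_zeta_summable[OF s]])
  then have "(\<lambda>Y. real_zeta s - ?t Y + 1) \<longlonglongrightarrow> real_zeta s - real_zeta s + 1"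
    by (intro tendsto_intros)
  then have upper_lim: "(\<lambda>Y. real_zeta s - ?t Y + 1) \<longlonglongrightarrow> 1" by simp
  have "(\<lambda>Y. real_zeta s * ?P Y) \<longlonglongrightarrow> 1"
  proof (rule tendsto_sandwich[OF _ _ tendsto_const[of 1] upper_lim])
    show "eventually (\<lambda>Y. 1 \<le> real_zeta s * ?P Y) sequentially"
      using lower by (intro always_eventually) blast
    show "eventually (\<lambda>Y. real_zeta s * ?P Y \<le> real_zeta s - ?t Y + 1) sequentially"
      using eventually_ge_at_top[of 1] by eventually_elim (rule upper)
  qed
  from tendsto_divide[OF this tendsto_const[of "real_zeta s"]] show ?thesis
    using real_zeta_ge_1[OF s] by (simp add: has_euler_product_def)
qed

text \<open>Each partial sum of the zeta series is continuous at \<open>s = 1\<close>, where it is a harmonic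
  number.\<close>

lemma real_zeta_unbounded:
  obtains s where "s > 1" "real_zeta s > B"
proof -
  have "eventually (\<lambda>N. (harm N :: real) > B) sequentially"
    using harm_at_top filterlim_at_top_dense by blast
  then obtain N where N: "(harm N :: real) > B" by (auto simp: eventually_at_top_linorder)
  have "((\<lambda>s. \<Sum>k<N. 1 / real (Suc k) powr s) \<longlongrightarrow> (\<Sum>k<N. 1 / real (Suc k) powr 1)) (at_right 1)"
    by (intro tendsto_intros) auto
  moreover have "(\<Sum>k<N. 1 / real (Suc k) powr 1) = harm N"
    unfolding harm_def by (rule sum.reindex_bij_witness[of _ "\<lambda>k. k - 1" Suc]) (auto simp: field_simps)
  ultimately have "eventually (\<lambda>s. (\<Sum>k<N. 1 / real (Suc k) powr s) > B) (at_right 1)"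
    using N by (auto intro: order_tendstoD)
  then have "eventually (\<lambda>s. s > 1 \<and> (\<Sum>k<N. 1 / real (Suc k) powr s) > B) (at_right 1)"
    using eventually_at_right_less by (rule eventually_conj[rotated])
  then obtain s where "s > 1" "(\<Sum>k<N. 1 / real (Suc k) powr s) > B"
    using eventually_happens'[OF trivial_limit_at_right_real] by blast
  then show ?thesis using that real_zeta_ge_partial_sum[of s N] by force
qed

text \<open>Comparison with \<open>1 - p\<^sup>-\<^sup>s\<close> for some \<open>s > 1\<close> with \<open>1/\<zeta>(s) < \<epsilon>\<close> takes the place of the divergence
  of the sum of the reciprocals of the primes.\<close>

lemma euler_product_one_minus_inverse_prime:
  "has_euler_product (\<lambda>p. 1 - 1 / real p) 0"
  unfolding has_euler_product_def
proof (rule tendstoI)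
  fix e :: real assume e: "e > 0"
  obtain s where s: "s > 1" "real_zeta s > 1 / e" by (rule real_zeta_unbounded)
  have "1 / real_zeta s < e" using s e real_zeta_ge_1[of s] by (simp add: field_simps)
  with euler_product_real_zeta[OF s(1)]
  have "eventually (\<lambda>Y. (\<Prod>p | prime p \<and> p \<le> Y. 1 - real p powr (-s)) < e) sequentially"
    unfolding has_euler_product_def by (rule order_tendstoD)
  then show "eventually (\<lambda>Y. dist (\<Prod>p | prime p \<and> p \<le> Y. 1 - 1 / real p) 0 < e) sequentially"
  proof eventually_elim
    case (elim Y)
    have p: "0 \<le> 1 - 1 / real p \<and> 1 - 1 / real p \<le> 1 - real p powr (-s)" if "prime p" for p
    proof -
      have "real p \<ge> 1" using prime_gt_0_nat[OF that] by simp
      moreover from this have "real p powr (-s) \<le> real p powr (-1)"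
        using s by (intro powr_mono) auto
      ultimately show ?thesis by (simp add: powr_minus field_simps)
    qed
    have "(\<Prod>p | prime p \<and> p \<le> Y. 1 - 1 / real p) \<le> (\<Prod>p | prime p \<and> p \<le> Y. 1 - real p powr (-s))"
      using p by (intro prod_mono) auto
    moreover have "0 \<le> (\<Prod>p | prime p \<and> p \<le> Y. 1 - 1 / real p)"
      using p by (intro prod_nonneg) auto
    ultimately show ?case using elim by (simp add: dist_real_def)
  qed
qed

section \<open>Asymptotics of sums over dilations\<close>

lemma asymp_equiv_cmult_iff:
  fixes f g :: "real \<Rightarrow> real"
  assumes c: "c \<noteq> 0" and g: "eventually (\<lambda>x. g x \<noteq> 0) F"
  shows "f \<sim>[F] (\<lambda>x. c * g x) \<longleftrightarrow> ((\<lambda>x. f x / g x) \<longlongrightarrow> c) F"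
proof
  assume "f \<sim>[F] (\<lambda>x. c * g x)"
  from tendsto_mult_left[OF asymp_equivD[OF this], of c]
  have "((\<lambda>x. c * (if f x = 0 \<and> c * g x = 0 then 1 else f x / (c * g x))) \<longlongrightarrow> c) F" by simp
  then show "((\<lambda>x. f x / g x) \<longlongrightarrow> c) F"
    by (rule Lim_transform_eventually) (use g in eventually_elim, use c in auto)
next
  assume "((\<lambda>x. f x / g x) \<longlongrightarrow> c) F"
  from tendsto_divide[OF this tendsto_const[of c]] c
  show "f \<sim>[F] (\<lambda>x. c * g x)" by (intro asymp_equivI') (simp add: mult.commute)
qed

text \<open>Powers scale exactly, and \<open>ln (X / k) / ln X\<close> tends to \<open>1\<close>, so the logarithmic factor does
  not see the dilation.\<close>

lemma tendsto_dilate: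
  fixes f :: "real \<Rightarrow> real"
  assumes f: "((\<lambda>X. f X / (X powr a * ln X powr b)) \<longlongrightarrow> L) at_top" and k: "k > 0"
  shows "((\<lambda>X. f (X / k) / (X powr a * ln X powr b)) \<longlongrightarrow> k powr (-a) * L) at_top"
proof -
  have lim: "filterlim (\<lambda>X. X / k) at_top at_top"
    using k by real_asymp
  have 1: "((\<lambda>X. f (X / k) / ((X / k) powr a * ln (X / k) powr b)) \<longlongrightarrow> L) at_top"
    using filterlim_compose[OF f lim] .
  have "((\<lambda>X. ln (X / k) / ln X) \<longlongrightarrow> 1) at_top"
    using k by real_asymp
  then have "((\<lambda>X. k powr (-a) * (ln (X / k) / ln X) powr b) \<longlongrightarrow> k powr (-a) * 1 powr b) at_top"
    by (intro tendsto_intros) auto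
  then have 2: "((\<lambda>X. k powr (-a) * (ln (X / k) / ln X) powr b) \<longlongrightarrow> k powr (-a)) at_top"
    by simp
  have "eventually (\<lambda>X. k powr (-a) * (ln (X / k) / ln X) powr b *
          (f (X / k) / ((X / k) powr a * ln (X / k) powr b)) = f (X / k) / (X powr a * ln X powr b)) at_top"
    using eventually_gt_at_top[of k] eventually_gt_at_top[of 1]
  proof eventually_elim
    case (elim X)
    then have "ln (X / k) > 0" "ln X > 0" using k by auto
    with elim k show ?case by (simp add: powr_divide powr_minus field_simps)
  qed
  from Lim_transform_eventually[OF tendsto_mult[OF 2 1] this] show ?thesis .
qed

text \<open>Monotonicity supplies the bound on the bounded range where the limit says nothing. The factor is
  \<open>1 + ln x\<close> because \<open>ln x\<close> vanishes at \<open>x = 1\<close>, where \<open>p\<close> need not.\<close>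

lemma mono_powr_log_bound:
  fixes p :: "real \<Rightarrow> real"
  assumes mono: "mono p" and nonneg: "\<And>x. p x \<ge> 0" and \<alpha>: "\<alpha> \<ge> 0" and \<beta>: "\<beta> \<ge> 0"
    and lim: "((\<lambda>X. p X / (X powr \<alpha> * ln X powr \<beta>)) \<longlongrightarrow> c) at_top"
  obtains C where "C \<ge> 0" "\<And>x. x \<ge> 1 \<Longrightarrow> p x \<le> C * (x powr \<alpha> * (1 + ln x) powr \<beta>)"
proof -
  have "eventually (\<lambda>X. p X / (X powr \<alpha> * ln X powr \<beta>) < c + 1 \<and> X > 1) at_top"
    using lim by (intro eventually_conj order_tendstoD eventually_gt_at_top) auto
  then obtain Y where Y: "\<And>X. X \<ge> Y \<Longrightarrow> p X / (X powr \<alpha> * ln X powr \<beta>) < c + 1 \<and> X > 1"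
    by (auto simp: eventually_at_top_linorder)
  show ?thesis
  proof (rule that[of "\<bar>c + 1\<bar> + p Y"])
    show "\<bar>c + 1\<bar> + p Y \<ge> 0" using nonneg[of Y] by simp
    fix x :: real assume x: "x \<ge> 1"
    show "p x \<le> (\<bar>c + 1\<bar> + p Y) * (x powr \<alpha> * (1 + ln x) powr \<beta>)"
    proof (cases "x \<ge> Y")
      case True
      from Y[OF this] have x1: "x > 1" and "p x / (x powr \<alpha> * ln x powr \<beta>) < c + 1" by auto
      moreover have "x powr \<alpha> * ln x powr \<beta> > 0" using x1 by simp
      ultimately have "p x \<le> (c + 1) * (x powr \<alpha> * ln x powr \<beta>)"
        by (simp add: pos_divide_less_eq)
      also have "\<dots> \<le> (\<bar>c + 1\<bar> + p Y) * (x powr \<alpha> * (1 + ln x) powr \<beta>)"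
        using x1 \<beta> nonneg[of Y] by (intro mult_mono mult_nonneg_nonneg powr_mono2 order.refl) auto
      finally show ?thesis .
    next
      case False
      then have "p x \<le> p Y" using mono by (auto intro: monoD)
      also have "\<dots> = p Y * (1 * 1)" by simp
      also have "\<dots> \<le> (\<bar>c + 1\<bar> + p Y) * (x powr \<alpha> * (1 + ln x) powr \<beta>)"
        using x \<alpha> \<beta> nonneg[of Y] by (intro mult_mono ge_one_powr_ge_zero) auto
      finally show ?thesis .
    qed
  qed
qed

text \<open>By Tannery's theorem, with dominating series a multiple of \<open>\<Sum>k. k\<^sup>-\<^sup>\<alpha>\<close>. Vanishing of \<open>p\<close> below \<open>1\<close>
  turns the sum over \<open>k \<le> X\<close> into an infinite series with a range independent of \<open>X\<close>.\<close>

lemma dilate_sum_asymp_gt_1: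
  fixes p :: "real \<Rightarrow> real"
  assumes mono: "mono p" and nonneg: "\<And>x. p x \<ge> 0" and zero: "\<And>x. x < 1 \<Longrightarrow> p x = 0"
    and \<alpha>: "\<alpha> > 1" and \<beta>: "\<beta> \<ge> 0"
    and lim: "((\<lambda>X. p X / (X powr \<alpha> * ln X powr \<beta>)) \<longlongrightarrow> c) at_top"
  shows "((\<lambda>X. (\<Sum>k=1..nat \<lfloor>X\<rfloor>. p (X / real k)) / (X powr \<alpha> * ln X powr \<beta>))
            \<longlongrightarrow> c * real_zeta \<alpha>) at_top"
proof -
  obtain C where C: "C \<ge> 0" "\<And>x. x \<ge> 1 \<Longrightarrow> p x \<le> C * (x powr \<alpha> * (1 + ln x) powr \<beta>)"
    using mono_powr_log_bound[OF mono nonneg _ \<beta> lim] \<alpha> by auto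
  define a where "a = (\<lambda>k X. p (X / real (Suc k)) / (X powr \<alpha> * ln X powr \<beta>))"
  define b where "b = (\<lambda>k. c * (1 / real (Suc k) powr \<alpha>))"
  define M where "M = (\<lambda>k. C * 2 powr \<beta> * (1 / real (Suc k) powr \<alpha>))"
  have sM: "summable M"
    unfolding M_def using real_zeta_summable[OF \<alpha>] by (rule summable_mult)
  have limit: "(a k \<longlongrightarrow> b k) at_top" for k
    using tendsto_dilate[OF lim, of "real (Suc k)"]
    by (simp add: a_def b_def powr_minus field_simps del: of_nat_Suc)
  \<comment> \<open>The threshold \<open>exp 1\<close> ensures \<open>1 + ln (X / k) \<le> 2 * ln X\<close>, whence the factor \<open>2 powr \<beta>\<close> in
    the majorant.\<close>
  have bnd: "norm (a k X) \<le> M k" if X: "X \<ge> exp 1" for k X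
  proof (cases "X / real (Suc k) < 1")
    case True
    then show ?thesis using C(1) by (simp add: a_def M_def zero)
  next
    case False
    let ?x = "X / real (Suc k)"
    have X1: "X > 1" using X exp_gt_one[of "1::real"] by linarith
    have lnX: "ln X \<ge> 1" using X X1 by (simp add: ln_ge_iff)
    have "?x \<le> X" using X1 by (simp add: field_simps)
    then have le: "ln ?x \<le> ln X" "ln ?x \<ge> 0" using False X1 by (auto intro!: ln_mono)
    have "p ?x \<le> C * (?x powr \<alpha> * (1 + ln ?x) powr \<beta>)" using C(2) False by simp
    also have "\<dots> \<le> C * (?x powr \<alpha> * (2 * ln X) powr \<beta>)"
      using C(1) le lnX \<beta> by (intro mult_left_mono powr_mono2) auto
    also have "\<dots> = M k * (X powr \<alpha> * ln X powr \<beta>)"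
      using X1 lnX by (simp add: M_def powr_mult powr_divide field_simps)
    finally have "a k X \<le> M k"
      using X1 lnX by (simp add: a_def pos_divide_le_eq)
    then show ?thesis using X1 nonneg by (simp add: a_def)
  qed
  have "eventually (\<lambda>(k, X). norm (a k X) \<le> M k) (at_top \<times>\<^sub>F at_top)"
    using eventually_ge_at_top[of "exp (1::real)"] bnd
    by (auto simp: eventually_prod_filter intro!: exI[of _ "\<lambda>_. True"] exI[of _ "\<lambda>X. X \<ge> exp 1"])
  from tannerys_theorem[OF limit this sM]
  have T: "((\<lambda>X. suminf (\<lambda>k. a k X)) \<longlongrightarrow> suminf b) at_top" by auto
  have "suminf b = c * real_zeta \<alpha>"
    unfolding b_def real_zeta_def using real_zeta_summable[OF \<alpha>] by (rule suminf_mult)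
  moreover have "suminf (\<lambda>k. a k X) = (\<Sum>k=1..nat \<lfloor>X\<rfloor>. p (X / real k)) / (X powr \<alpha> * ln X powr \<beta>)" for X
  proof -
    have "a k X = 0" if "k \<notin> {..<nat \<lfloor>X\<rfloor>}" for k
    proof -
      have "X < real (Suc k)" using that by (simp add: not_less nat_le_iff floor_le_iff)
      then show ?thesis by (simp add: a_def zero field_simps)
    qed
    then have "suminf (\<lambda>k. a k X) = (\<Sum>k<nat \<lfloor>X\<rfloor>. a k X)" by (intro suminf_finite) auto
    also have "\<dots> = (\<Sum>k=1..nat \<lfloor>X\<rfloor>. p (X / real k)) / (X powr \<alpha> * ln X powr \<beta>)"
      unfolding a_def sum_divide_distrib by (rule sum.reindex_bij_witness[of _ "\<lambda>k. k - 1" Suc]) auto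
    finally show ?thesis .
  qed
  ultimately show ?thesis using T by simp
qed

text \<open>The two bounds compare the integral of \<open>z\<^sup>\<beta>\<close> over \<open>[x, y]\<close> with the rectangles of extreme height;
  the mean value theorem copes with the endpoint \<open>x = 0\<close>, where the antiderivative is only required
  to be continuous.\<close>

lemma powr_diff_bounds:
  fixes x y \<beta> :: real
  assumes "0 \<le> x" "x \<le> y" "\<beta> \<ge> 0"
  shows "x powr \<beta> * (y - x) \<le> (y powr (\<beta> + 1) - x powr (\<beta> + 1)) / (\<beta> + 1)"
    and "(y powr (\<beta> + 1) - x powr (\<beta> + 1)) / (\<beta> + 1) \<le> y powr \<beta> * (y - x)"
proof -
  have *: "x powr \<beta> * (y - x) \<le> (y powr (\<beta> + 1) - x powr (\<beta> + 1)) / (\<beta> + 1) \<and>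
     (y powr (\<beta> + 1) - x powr (\<beta> + 1)) / (\<beta> + 1) \<le> y powr \<beta> * (y - x)"
  proof (cases "x < y")
    case True
    have "continuous_on {x..y} (\<lambda>z. z powr (\<beta> + 1) / (\<beta> + 1))"
      using assms by (intro continuous_intros continuous_on_powr') auto
    moreover have "((\<lambda>z. z powr (\<beta> + 1) / (\<beta> + 1)) has_real_derivative z powr \<beta>) (at z)"
      if "x < z" for z
      using that assms by (auto intro!: derivative_eq_intros)
    ultimately obtain z where z: "x < z" "z < y"
      "y powr (\<beta> + 1) / (\<beta> + 1) - x powr (\<beta> + 1) / (\<beta> + 1) = (y - x) * z powr \<beta>"
      using MVT[OF True, of "\<lambda>z. z powr (\<beta> + 1) / (\<beta> + 1)"]
      by (metis DERIV_unique real_differentiable_def)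
    have "x powr \<beta> \<le> z powr \<beta>" "z powr \<beta> \<le> y powr \<beta>"
      using z assms by (auto intro!: powr_mono2)
    with z True show ?thesis by (simp add: diff_divide_distrib mult.commute mult_left_mono)
  qed (use assms in auto)
  from * show "x powr \<beta> * (y - x) \<le> (y powr (\<beta> + 1) - x powr (\<beta> + 1)) / (\<beta> + 1)"
    and "(y powr (\<beta> + 1) - x powr (\<beta> + 1)) / (\<beta> + 1) \<le> y powr \<beta> * (y - x)" by auto
qed

text \<open>The integral test for the decreasing function \<open>f\<close>, with \<open>- G\<close> as its antiderivative. In the
  variable \<open>ln (X / k)\<close> each step is a rectangle estimate for \<open>z\<^sup>\<beta>\<close> on an interval whose length
  \<open>ln (1 + 1/k)\<close> lies between \<open>1/(k+1)\<close> and \<open>1/k\<close>.\<close>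

lemma log_sum_bounds:
  fixes X \<beta> :: real
  assumes \<beta>: "\<beta> \<ge> 0" and m: "m \<ge> 1" "real m \<le> X"
  defines "G \<equiv> \<lambda>k. ln (X / real k) powr (\<beta> + 1) / (\<beta> + 1)"
  defines "f \<equiv> \<lambda>k. ln (X / real k) powr \<beta> / real k"
  shows "G 1 - G m \<le> sum f {1..<m} \<and> sum f {1..m} \<le> f 1 + (G 1 - G m)"
  using m
proof (induction m rule: dec_induct)
  case base
  show ?case by (simp add: f_def)
next
  case (step k)
  have k: "real k > 0" "real (Suc k) > 0" "X > 0" "real k + 1 \<le> X" using step by auto
  define x where "x = ln (X / real (Suc k))"
  define y where "y = ln (X / real k)"
  have x0: "0 \<le> x" using k by (simp add: x_def)
  have xy: "y - x = ln (1 + 1 / real k)"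
  proof -
    have "1 + 1 / real k = real (Suc k) / real k" using k by (simp add: field_simps)
    then show ?thesis using k by (simp add: x_def y_def ln_div)
  qed
  have up: "y - x \<le> 1 / real k" unfolding xy by (rule ln_add_one_self_le_self) simp
  have "x - y \<le> - 1 / real (Suc k)"
  proof -
    have "x - y = ln (1 + (- 1 / real (Suc k)))"
    proof -
      have "1 + (- 1 / real (Suc k)) = real k / real (Suc k)" by (simp add: field_simps)
      then show ?thesis using k by (simp only: x_def y_def) (simp add: ln_div)
    qed
    also have "\<dots> \<le> - 1 / real (Suc k)"
      using k by (intro ln_add_one_self_le_self2) (simp add: field_simps)
    finally show ?thesis .
  qed
  then have lo: "1 / real (Suc k) \<le> y - x" by simp
  have le: "x \<le> y" using order.trans[OF _ lo, of 0] by simp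
  have "f (Suc k) = x powr \<beta> * (1 / real (Suc k))" by (simp add: f_def x_def)
  also have "\<dots> \<le> x powr \<beta> * (y - x)" using lo by (intro mult_left_mono) auto
  also have "\<dots> \<le> G k - G (Suc k)"
    using powr_diff_bounds(1)[OF x0 le \<beta>] by (simp add: G_def x_def y_def diff_divide_distrib)
  finally have A: "f (Suc k) \<le> G k - G (Suc k)" .
  have "G k - G (Suc k) \<le> y powr \<beta> * (y - x)"
    using powr_diff_bounds(2)[OF x0 le \<beta>] by (simp add: G_def x_def y_def diff_divide_distrib)
  also have "\<dots> \<le> y powr \<beta> * (1 / real k)" using up by (intro mult_left_mono) auto
  also have "\<dots> = f k" by (simp add: f_def y_def)
  finally have B: "G k - G (Suc k) \<le> f k" .
  have "G 1 - G k \<le> sum f {1..<k} \<and> sum f {1..k} \<le> f 1 + (G 1 - G k)"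
    using step by auto
  then show ?case using A B step(1) by simp
qed

text \<open>In the integral test with \<open>m = \<lfloor>X\<rfloor>\<close> the end term \<open>G m\<close> stays bounded because \<open>X / m \<le> 2\<close>, and
  the first term \<open>ln X powr \<beta>\<close> is smaller than the main term by a factor \<open>ln X\<close>.\<close>

lemma log_sum_asymp:
  fixes \<beta> :: real
  assumes \<beta>: "\<beta> \<ge> 0"
  shows "((\<lambda>X. (\<Sum>k=1..nat \<lfloor>X\<rfloor>. ln (X / real k) powr \<beta> / real k) / ln X powr (\<beta> + 1))
           \<longlongrightarrow> 1 / (\<beta> + 1)) at_top"
proof (rule tendsto_sandwich)
  let ?S = "\<lambda>X::real. \<Sum>k=1..nat \<lfloor>X\<rfloor>. ln (X / real k) powr \<beta> / real k"
  define d where "d = ln 2 powr (\<beta> + 1) / (\<beta> + 1)"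
  have bnd: "(1 / (\<beta> + 1) - d / ln X powr (\<beta> + 1) \<le> ?S X / ln X powr (\<beta> + 1)) \<and>
     ?S X / ln X powr (\<beta> + 1) \<le> 1 / (\<beta> + 1) + 1 / ln X" if X: "X > 1" for X
  proof -
    define m where "m = nat \<lfloor>X\<rfloor>"
    have m: "m \<ge> 1" "real m \<le> X" "X < real m + 1"
      using X by (auto simp: m_def le_nat_iff le_floor_iff)
    have lnX: "ln X > 0" using X by simp
    note b = log_sum_bounds[OF \<beta> m(1,2)]
    have "X / real m \<le> 2" using m by (simp add: field_simps)
    then have "ln (X / real m) powr (\<beta> + 1) / (\<beta> + 1) \<le> d"
      unfolding d_def using m \<beta> by (intro divide_right_mono powr_mono2 ln_mono) auto
    moreover have "ln (X / real m) powr (\<beta> + 1) / (\<beta> + 1) \<ge> 0" using \<beta> by simp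
    moreover have "(\<Sum>k=1..<m. ln (X / real k) powr \<beta> / real k) \<le> ?S X"
      unfolding m_def[symmetric] using m by (intro sum_mono2) auto
    ultimately have "ln X powr (\<beta> + 1) / (\<beta> + 1) - d \<le> ?S X"
      "?S X \<le> ln X powr \<beta> + ln X powr (\<beta> + 1) / (\<beta> + 1)"
      using b by (auto simp: m_def[symmetric])
    then have "(ln X powr (\<beta> + 1) / (\<beta> + 1) - d) / ln X powr (\<beta> + 1) \<le> ?S X / ln X powr (\<beta> + 1)"
      "?S X / ln X powr (\<beta> + 1) \<le> (ln X powr \<beta> + ln X powr (\<beta> + 1) / (\<beta> + 1)) / ln X powr (\<beta> + 1)"
      by (intro divide_right_mono; simp)+
    moreover have "ln X powr \<beta> / ln X powr (\<beta> + 1) = 1 / ln X"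
      using lnX by (simp add: powr_add)
    ultimately show ?thesis using lnX by (simp add: diff_divide_distrib add_divide_distrib)
  qed
  show "eventually (\<lambda>X. 1 / (\<beta> + 1) - d / ln X powr (\<beta> + 1) \<le> ?S X / ln X powr (\<beta> + 1)) at_top"
    using eventually_gt_at_top[of 1] by eventually_elim (use bnd in blast)
  show "eventually (\<lambda>X. ?S X / ln X powr (\<beta> + 1) \<le> 1 / (\<beta> + 1) + 1 / ln X) at_top"
    using eventually_gt_at_top[of 1] by eventually_elim (use bnd in blast)
  show "((\<lambda>X. 1 / (\<beta> + 1) - d / ln X powr (\<beta> + 1)) \<longlongrightarrow> 1 / (\<beta> + 1)) at_top"
  proof -
    have "\<beta> + 1 > 0" using \<beta> by simp
    then show ?thesis by real_asymp
  qed
  show "((\<lambda>X::real. 1 / (\<beta> + 1) + 1 / ln X) \<longlongrightarrow> 1 / (\<beta> + 1)) at_top"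
    by real_asymp
qed

text \<open>A bound valid for all \<open>x \<ge> 1\<close> is required because the sum over dilations evaluates \<open>p\<close> at every
  scale \<open>X / k\<close>, down to \<open>1\<close>. The additive constant absorbs the range in which the asymptotics is
  not yet accurate.\<close>

lemma asymp_error_bound:
  fixes p :: "real \<Rightarrow> real"
  assumes mono: "mono p" and nonneg: "\<And>x. p x \<ge> 0" and c: "c \<ge> 0" and \<beta>: "\<beta> \<ge> 0"
    and lim: "((\<lambda>X. p X / (X * ln X powr \<beta>)) \<longlongrightarrow> c) at_top" and e: "e > 0"
  obtains K where "\<And>x. x \<ge> 1 \<Longrightarrow> \<bar>p x - c * (x * ln x powr \<beta>)\<bar> \<le> e * (x * ln x powr \<beta>) + K"
proof -
  have "eventually (\<lambda>X. dist (p X / (X * ln X powr \<beta>)) c < e \<and> X > 1) at_top"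
    using tendstoD[OF lim e] by (intro eventually_conj eventually_gt_at_top)
  then obtain Y where Y: "\<And>X. X \<ge> Y \<Longrightarrow> dist (p X / (X * ln X powr \<beta>)) c < e \<and> X > 1"
    by (auto simp: eventually_at_top_linorder)
  have Y1: "Y > 1" using Y[of Y] by simp
  let ?K = "p Y + c * (Y * ln Y powr \<beta>)"
  have K: "?K \<ge> 0" using nonneg[of Y] c Y1 by simp
  show ?thesis
  proof (rule that[of ?K])
    fix x :: real assume x: "x \<ge> 1"
    have s0: "x * ln x powr \<beta> \<ge> 0" using x by simp
    show "\<bar>p x - c * (x * ln x powr \<beta>)\<bar> \<le> e * (x * ln x powr \<beta>) + ?K"
    proof (cases "x \<ge> Y")
      case True
      from Y[OF this] have x1: "x > 1" and d: "\<bar>p x / (x * ln x powr \<beta>) - c\<bar> < e"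
        by (auto simp: dist_real_def)
      have s: "x * ln x powr \<beta> > 0" using x1 by simp
      have "\<bar>p x - c * (x * ln x powr \<beta>)\<bar> = \<bar>(p x / (x * ln x powr \<beta>) - c) * (x * ln x powr \<beta>)\<bar>"
        using x1 by (simp add: algebra_simps)
      also have "\<dots> = \<bar>p x / (x * ln x powr \<beta>) - c\<bar> * (x * ln x powr \<beta>)"
        by (simp only: abs_mult[of _ "x * ln x powr \<beta>"] abs_of_pos[OF s])
      also have "\<dots> \<le> e * (x * ln x powr \<beta>)" using d s by (intro mult_right_mono) auto
      finally show ?thesis using K by simp
    next
      case False
      have "p x \<le> p Y" using mono False by (auto intro: monoD)
      moreover have "c * (x * ln x powr \<beta>) \<le> c * (Y * ln Y powr \<beta>)"
        using False x c \<beta> by (intro mult_left_mono mult_mono powr_mono2 ln_mono) auto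
      moreover have "e * (x * ln x powr \<beta>) \<ge> 0" "c * (x * ln x powr \<beta>) \<ge> 0" using s0 e c by auto
      ultimately show ?thesis using nonneg[of x] nonneg[of Y] by (auto simp: abs_le_iff)
    qed
  qed
qed

text \<open>No single dilation dominates here, since \<open>\<Sum>k. 1/k\<close> diverges; instead \<open>p\<close> is replaced by its
  asymptotic value in every term. The relative errors \<open>\<epsilon>\<close> add up to \<open>\<epsilon>\<close> times the main term, and
  the constants \<open>K\<close> to at most \<open>K X\<close>, which is negligible against \<open>X (ln X)\<^sup>\<beta>\<^sup>+\<^sup>1\<close>.\<close>

lemma dilate_sum_asymp_1:
  fixes p :: "real \<Rightarrow> real"
  assumes mono: "mono p" and nonneg: "\<And>x. p x \<ge> 0" and c: "c \<ge> 0" and \<beta>: "\<beta> \<ge> 0"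
    and lim: "((\<lambda>X. p X / (X * ln X powr \<beta>)) \<longlongrightarrow> c) at_top"
  shows "((\<lambda>X. (\<Sum>k=1..nat \<lfloor>X\<rfloor>. p (X / real k)) / (X * ln X powr (\<beta> + 1)))
            \<longlongrightarrow> c / (\<beta> + 1)) at_top"
proof -
  let ?N = "\<lambda>X. \<Sum>k=1..nat \<lfloor>X\<rfloor>. p (X / real k)"
  let ?S = "\<lambda>X::real. \<Sum>k=1..nat \<lfloor>X\<rfloor>. ln (X / real k) powr \<beta> / real k"
  let ?L = "\<lambda>X::real. ln X powr (\<beta> + 1)"
  note S = log_sum_asymp[OF \<beta>]
  have b1: "\<beta> + 1 > 0" using \<beta> by simp
  have "((\<lambda>X. ?N X / (X * ?L X) - c * (?S X / ?L X)) \<longlongrightarrow> 0) at_top"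
  proof (rule tendstoI)
    fix e :: real assume e: "e > 0"
    obtain K where K: "\<And>x. x \<ge> 1 \<Longrightarrow> \<bar>p x - c * (x * ln x powr \<beta>)\<bar> \<le> e/2 * (x * ln x powr \<beta>) + K"
      using asymp_error_bound[OF mono nonneg c \<beta> lim, of "e/2"] e by auto
    have main: "\<bar>?N X / (X * ?L X) - c * (?S X / ?L X)\<bar> \<le> e / 2 * (?S X / ?L X) + \<bar>K\<bar> / ?L X"
      if X: "X > 1" for X
    proof -
      have XS: "X * ?S X = (\<Sum>k=1..nat \<lfloor>X\<rfloor>. X / real k * ln (X / real k) powr \<beta>)"
        by (simp add: sum_distrib_left)
      have "\<bar>?N X - c * (X * ?S X)\<bar> \<le>
          (\<Sum>k=1..nat \<lfloor>X\<rfloor>. \<bar>p (X / real k) - c * (X / real k * ln (X / real k) powr \<beta>)\<bar>)"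
        unfolding XS sum_distrib_left[of c] sum_subtractf[symmetric] by (rule sum_abs)
      also have "\<dots> \<le> (\<Sum>k=1..nat \<lfloor>X\<rfloor>. e/2 * (X / real k * ln (X / real k) powr \<beta>) + K)"
      proof (rule sum_mono)
        fix k assume k: "k \<in> {1..nat \<lfloor>X\<rfloor>}"
        then have "real k \<le> X" "k \<ge> 1" using X by (auto simp: le_nat_iff le_floor_iff)
        then have "X / real k \<ge> 1" by (simp add: field_simps)
        from K[OF this] show "\<bar>p (X / real k) - c * (X / real k * ln (X / real k) powr \<beta>)\<bar>
          \<le> e/2 * (X / real k * ln (X / real k) powr \<beta>) + K" .
      qed
      also have "\<dots> = e/2 * (X * ?S X) + real (nat \<lfloor>X\<rfloor>) * K"
        unfolding XS by (simp only: sum.distrib sum_distrib_left) simp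
      also have "real (nat \<lfloor>X\<rfloor>) * K \<le> X * \<bar>K\<bar>"
        using X by (intro order.trans[OF mult_left_mono[OF abs_ge_self] mult_right_mono]) auto
      finally have "\<bar>?N X - c * (X * ?S X)\<bar> / (X * ?L X) \<le> (e/2 * (X * ?S X) + X * \<bar>K\<bar>) / (X * ?L X)"
        using X by (intro divide_right_mono) auto
      moreover have "?N X / (X * ?L X) - c * (?S X / ?L X) = (?N X - c * (X * ?S X)) / (X * ?L X)"
        using X by (simp add: diff_divide_distrib)
      moreover have "(e/2 * (X * ?S X) + X * \<bar>K\<bar>) / (X * ?L X) = e / 2 * (?S X / ?L X) + \<bar>K\<bar> / ?L X"
        using X by (simp add: add_divide_distrib)
      moreover have "\<bar>X * ?L X\<bar> = X * ?L X" using X by simp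
      ultimately show ?thesis by (simp only: abs_divide)
    qed
    have "((\<lambda>X. \<bar>K\<bar> / ?L X) \<longlongrightarrow> 0) at_top" using b1 by real_asymp
    then have "((\<lambda>X. e / 2 * (?S X / ?L X) + \<bar>K\<bar> / ?L X) \<longlongrightarrow> e / 2 * (1 / (\<beta> + 1)) + 0) at_top"
      by (intro tendsto_intros S)
    moreover have "e / 2 * (1 / (\<beta> + 1)) + 0 < e" using e \<beta>
      by (simp add: field_simps add_strict_increasing)
    ultimately have "eventually (\<lambda>X. e / 2 * (?S X / ?L X) + \<bar>K\<bar> / ?L X < e) at_top"
      by (rule order_tendstoD)
    with eventually_gt_at_top[of 1]
    show "eventually (\<lambda>X. dist (?N X / (X * ?L X) - c * (?S X / ?L X)) 0 < e) at_top"
      by eventually_elim (use main in \<open>auto simp: dist_real_def intro: order.strict_trans1\<close>)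
  qed
  from tendsto_add[OF this tendsto_mult_left[OF S, of c]] show ?thesis by simp
qed

section \<open>Relative densities\<close>

lemma relative_density_by_scale:
  assumes S: "eventually (\<lambda>X. s X \<noteq> 0) at_top"
    and N: "((\<lambda>X. real (branch_count F X) / s X) \<longlongrightarrow> M) at_top" and M: "M \<noteq> 0"
    and A: "((\<lambda>X. real (card (A \<inter> branch_locus_upto F X)) / s X) \<longlongrightarrow> L) at_top"
  shows "has_relative_density F A (L / M)"
  unfolding has_relative_density_def
proof (rule Lim_transform_eventually[OF tendsto_divide[OF A N M]])
  show "eventually (\<lambda>X. real (card (A \<inter> branch_locus_upto F X)) / s X / (real (branch_count F X) / s X)
          = density_quotient F A X) at_top"
    using S by eventually_elim (simp add: density_quotient_def)
qed

text \<open>The invisible points up to height \<open>X\<close> are the \<open>p\<close>-multiples of all branch points up to height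
  \<open>X/p\<close>, so the density is \<open>1 - lim N(X/p)/N(X)\<close>. Only the growth of \<open>N\<close> enters, which lets the
  argument serve both \<open>\<alpha> > 1\<close> and \<open>\<alpha> = 1\<close> with the respective exponents of the logarithm.\<close>

lemma padically_visible_density:
  fixes F :: "'n::finite qpoly set"
  assumes hom: "\<forall>f\<in>F. homogeneous_qpoly f" and Y: "rational_ray_datum F Y" and p: "prime p"
    and N: "((\<lambda>X. real (branch_count F X) / (X powr a * ln X powr b)) \<longlongrightarrow> M) at_top"
    and M: "M \<noteq> 0"
  shows "has_relative_density F (padically_visible p F Y) (1 - real p powr (-a))"
proof -
  have p0: "p > 0" using p by (rule prime_gt_0_nat)
  have card: "real (card (padically_visible p F Y \<inter> branch_locus_upto F X)) =
          real (branch_count F X) - real (branch_count F (X / real p))" for X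
  proof -
    let ?D = "{P \<in> branch_locus_upto F X. int p dvd content P}"
    have sub: "?D \<subseteq> branch_locus_upto F X" by auto
    have "padically_visible p F Y \<inter> branch_locus_upto F X = branch_locus_upto F X - ?D"
      unfolding padically_visible_eq[OF hom Y p] by (auto simp: branch_locus_upto_def)
    then have "card (padically_visible p F Y \<inter> branch_locus_upto F X) =
        card (branch_locus_upto F X) - card ?D"
      by (simp only: card_Diff_subset[OF finite_subset[OF sub finite_branch_locus_upto] sub])
    moreover have "card ?D \<le> card (branch_locus_upto F X)"
      by (rule card_mono[OF finite_branch_locus_upto sub])
    ultimately show ?thesis
      by (simp add: card_dvd_content[OF hom p0] branch_count_def of_nat_diff)
  qed
  have "((\<lambda>X. real (branch_count F X) / (X powr a * ln X powr b)
            - real (branch_count F (X / real p)) / (X powr a * ln X powr b))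
          \<longlongrightarrow> M - real p powr (-a) * M) at_top"
    using p0 by (intro tendsto_diff N tendsto_dilate[OF N]) simp
  then have "((\<lambda>X. real (card (padically_visible p F Y \<inter> branch_locus_upto F X)) / (X powr a * ln X powr b))
          \<longlongrightarrow> M - real p powr (-a) * M) at_top"
    by (simp add: card diff_divide_distrib)
  moreover have "eventually (\<lambda>X::real. X powr a * ln X powr b \<noteq> 0) at_top"
    using eventually_gt_at_top[of 1] by eventually_elim simp
  ultimately have "has_relative_density F (padically_visible p F Y) ((M - real p powr (-a) * M) / M)"
    using relative_density_by_scale[OF _ N M] by blast
  moreover have "(M - real p powr (-a) * M) / M = 1 - real p powr (-a)"
    using M by (simp add: field_simps)
  ultimately show ?thesis by simp
qed

lemma card_globally_visible:
  assumes "\<forall>f\<in>F. homogeneous_qpoly f" "rational_ray_datum F Y"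
  shows "card (globally_visible F Y \<inter> branch_locus_upto F X) = primitive_count F X"
proof -
  have "globally_visible F Y \<inter> branch_locus_upto F X = {P \<in> branch_locus_upto F X. content P = 1}"
    unfolding globally_visible_eq[OF assms] by (auto simp: branch_locus_upto_def)
  then show ?thesis by (simp add: primitive_count_def content_def)
qed

lemma has_euler_product_relative_density:
  assumes "\<And>p. prime p \<Longrightarrow> has_relative_density F (S p) (d p)" and "has_euler_product d L"
  shows "has_euler_product (\<lambda>p. relative_density F (S p)) L"
proof -
  have "(\<Prod>p | prime p \<and> p \<le> Y. relative_density F (S p)) = (\<Prod>p | prime p \<and> p \<le> Y. d p)" for Y :: nat
    using assms(1) has_relative_density_imp_eq by (intro prod.cong) blast+
  then show ?thesis using assms(2) by (simp add: has_euler_product_def)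
qed

theorem proposition4p8:
  fixes F :: "'n::finite qpoly set"
    and Y :: "(real \<Rightarrow> real ^ 'n) set"
    and c \<alpha> \<beta> :: real
  assumes hom: "\<forall>f\<in>F. homogeneous_qpoly f"
    and nonempty: "positive_rational_points F \<noteq> {}"
    and datum: "rational_ray_datum F Y"
    and c: "c > 0" and \<alpha>: "\<alpha> \<ge> 1" and \<beta>: "\<beta> \<ge> 0"
    and asymp: "(\<lambda>X. real (primitive_count F X)) \<sim>[at_top] (\<lambda>X. c * X powr \<alpha> * ln X powr \<beta>)"
  shows "(\<alpha> > 1 \<longrightarrow>
            (\<lambda>X. real (branch_count F X)) \<sim>[at_top]
              (\<lambda>X. c * real_zeta \<alpha> * X powr \<alpha> * ln X powr \<beta>) \<and>
            has_relative_density F (globally_visible F Y) (1 / real_zeta \<alpha>) \<and>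
            (\<forall>p. prime p \<longrightarrow>
               has_relative_density F (padically_visible p F Y) (1 - real p powr (- \<alpha>))) \<and>
            has_euler_product (\<lambda>p. relative_density F (padically_visible p F Y))
              (relative_density F (globally_visible F Y))) \<and>
         (\<alpha> = 1 \<longrightarrow>
            (\<lambda>X. real (branch_count F X)) \<sim>[at_top]
              (\<lambda>X. c / (\<beta> + 1) * X * ln X powr (\<beta> + 1)) \<and>
            has_relative_density F (globally_visible F Y) 0 \<and>
            (\<forall>p. prime p \<longrightarrow>
               has_relative_density F (padically_visible p F Y) (1 - 1 / real p)) \<and>
            has_euler_product (\<lambda>p. relative_density F (padically_visible p F Y)) 0 \<and>
            has_euler_product (\<lambda>p. relative_density F (padically_visible p F Y))
              (relative_density F (globally_visible F Y)))"
proof -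
  let ?P = "\<lambda>X. real (primitive_count F X)"
  let ?N = "\<lambda>X. real (branch_count F X)"
  have nz: "eventually (\<lambda>X::real. X powr a * ln X powr b \<noteq> 0) at_top" for a b
    using eventually_gt_at_top[of 1] by eventually_elim simp
  have P: "((\<lambda>X. ?P X / (X powr \<alpha> * ln X powr \<beta>)) \<longlongrightarrow> c) at_top"
    using asymp asymp_equiv_cmult_iff[OF _ nz, of c ?P \<alpha> \<beta>] c by (simp add: mult.assoc)
  have mono: "mono ?P" using mono_primitive_count[of F] by (auto simp: mono_def)
  have N_sum: "?N X = (\<Sum>k=1..nat \<lfloor>X\<rfloor>. ?P (X / real k))" for X
    by (simp add: branch_count_eq_sum[OF hom])
  have gt: "?N \<sim>[at_top] (\<lambda>X. c * real_zeta \<alpha> * X powr \<alpha> * ln X powr \<beta>) \<and>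
            has_relative_density F (globally_visible F Y) (1 / real_zeta \<alpha>) \<and>
            (\<forall>p. prime p \<longrightarrow>
               has_relative_density F (padically_visible p F Y) (1 - real p powr (- \<alpha>))) \<and>
            has_euler_product (\<lambda>p. relative_density F (padically_visible p F Y))
              (relative_density F (globally_visible F Y))" if "\<alpha> > 1"
  proof (intro conjI allI impI)
    have M: "c * real_zeta \<alpha> \<noteq> 0" using c real_zeta_ge_1[OF that] by simp
    have N: "((\<lambda>X. ?N X / (X powr \<alpha> * ln X powr \<beta>)) \<longlongrightarrow> c * real_zeta \<alpha>) at_top"
      unfolding N_sum
      by (rule dilate_sum_asymp_gt_1[OF mono _ _ that \<beta> P]) (auto simp: primitive_count_eq_0)
    show "?N \<sim>[at_top] (\<lambda>X. c * real_zeta \<alpha> * X powr \<alpha> * ln X powr \<beta>)"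
      using N asymp_equiv_cmult_iff[OF M nz, of ?N \<alpha> \<beta>] by (simp add: mult.assoc)
    have "has_relative_density F (globally_visible F Y) (c / (c * real_zeta \<alpha>))"
      using P by (intro relative_density_by_scale[OF nz N M]) (simp add: card_globally_visible[OF hom datum])
    then show G: "has_relative_density F (globally_visible F Y) (1 / real_zeta \<alpha>)" using c by simp
    show L: "has_relative_density F (padically_visible p F Y) (1 - real p powr (- \<alpha>))" if "prime p" for p
      by (rule padically_visible_density[OF hom datum that N M])
    show "has_euler_product (\<lambda>p. relative_density F (padically_visible p F Y))
              (relative_density F (globally_visible F Y))"
      unfolding has_relative_density_imp_eq[OF G]
      by (rule has_euler_product_relative_density[OF L euler_product_real_zeta[OF that]])
  qed
  have eq: "?N \<sim>[at_top] (\<lambda>X. c / (\<beta> + 1) * X * ln X powr (\<beta> + 1)) \<and>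
            has_relative_density F (globally_visible F Y) 0 \<and>
            (\<forall>p. prime p \<longrightarrow>
               has_relative_density F (padically_visible p F Y) (1 - 1 / real p)) \<and>
            has_euler_product (\<lambda>p. relative_density F (padically_visible p F Y)) 0 \<and>
            has_euler_product (\<lambda>p. relative_density F (padically_visible p F Y))
              (relative_density F (globally_visible F Y))" if "\<alpha> = 1"
  proof (intro conjI allI impI)
    have M: "c / (\<beta> + 1) \<noteq> 0" using c \<beta> by simp
    have powr_1: "eventually (\<lambda>X::real. X powr 1 = X) at_top"
      using eventually_ge_at_top[of 0] by eventually_elim simp
    have P1: "((\<lambda>X. ?P X / (X * ln X powr \<beta>)) \<longlongrightarrow> c) at_top"
      by (rule Lim_transform_eventually[OF P]) (use powr_1 in eventually_elim, simp add: that)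
    have N1: "((\<lambda>X. ?N X / (X * ln X powr (\<beta> + 1))) \<longlongrightarrow> c / (\<beta> + 1)) at_top"
      unfolding N_sum using c by (intro dilate_sum_asymp_1[OF mono _ _ \<beta> P1]) auto
    have N: "((\<lambda>X. ?N X / (X powr 1 * ln X powr (\<beta> + 1))) \<longlongrightarrow> c / (\<beta> + 1)) at_top"
      by (rule Lim_transform_eventually[OF N1]) (use powr_1 in eventually_elim, simp)
    have nz1: "eventually (\<lambda>X::real. X * ln X powr (\<beta> + 1) \<noteq> 0) at_top"
      using eventually_gt_at_top[of 1] by eventually_elim simp
    show "?N \<sim>[at_top] (\<lambda>X. c / (\<beta> + 1) * X * ln X powr (\<beta> + 1))"
      using N1 asymp_equiv_cmult_iff[OF M nz1, of ?N] by (simp add: mult.assoc)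
    have "((\<lambda>X::real. 1 / ln X) \<longlongrightarrow> 0) at_top" by real_asymp
    from tendsto_mult[OF P1 this]
    have "((\<lambda>X. ?P X / (X * ln X powr \<beta>) * (1 / ln X)) \<longlongrightarrow> 0) at_top" by simp
    then have "((\<lambda>X. ?P X / (X * ln X powr (\<beta> + 1))) \<longlongrightarrow> 0) at_top"
      by (rule Lim_transform_eventually)
         (use eventually_gt_at_top[of 1] in eventually_elim, simp add: powr_add)
    then have "has_relative_density F (globally_visible F Y) (0 / (c / (\<beta> + 1)))"
      by (intro relative_density_by_scale[OF nz1 N1 M]) (simp add: card_globally_visible[OF hom datum])
    then show G: "has_relative_density F (globally_visible F Y) 0" by simp
    show L: "has_relative_density F (padically_visible p F Y) (1 - 1 / real p)" if "prime p" for p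
      using padically_visible_density[OF hom datum that N M] by (simp add: powr_minus_divide)
    show E: "has_euler_product (\<lambda>p. relative_density F (padically_visible p F Y)) 0"
      by (rule has_euler_product_relative_density[OF L euler_product_one_minus_inverse_prime])
    then show "has_euler_product (\<lambda>p. relative_density F (padically_visible p F Y))
              (relative_density F (globally_visible F Y))"
      unfolding has_relative_density_imp_eq[OF G] .
  qed
  from gt eq show ?thesis by blast
qed

end
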